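(* Let $\mathcal{T}_n$ be the Associahedron on $n+1$ letters (the Tamari lattice). If $\alpha$ is an atomic cover of $\mathcal{T}_n$, then $\mathrm{Cov}(\mathcal{T}_n,\alpha)$ is isomorphic (as a poset) to $\mathcal{T}_{n-1}$.
   Context: $\mathcal{T}_n$ is represented as the set of bracketing vectors with the pointwise order: a bracketing vector is a vector $v\in\{1,\ldots,n\}^n$ such that (i) $i\le v_i$ for all $i$, and (ii) $i<j\le v_i$ implies $v_j\le v_i$. It is a finite lattice. For a finite lattice $L$, $\mathrm{Cov}(L)$ is the set of pairs $\gamma=(\gamma_0,\gamma_1)\in L^2$ such that $\gamma_0<\gamma_1$ with no element strictly between, partially ordered by: $\gamma\le\delta$ iff $\gamma_0\le\delta_0$, $\gamma_1\not\le\delta_0$ and $\gamma_1\le\delta_1$. $\mathrm{Cov}(L,\gamma)$ denotes the connected component of $\gamma$ in this poset (with respect to comparability), with the induced order. An atomic cover of $L$ is a cover of the form $(\bot,\alpha_1)$, where $\bot$ is the least element and $\alpha_1$ is an atom of $L$. *)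

theory Defs
  imports Main "HOL-Library.FuncSet"
begin

text \<open>
  A finite poset or lattice is rendered as a set \<open>L\<close> of elements of an order type, with the
  order induced from the type.
\<close>

text \<open>
  Vectors in \<open>{1,\<dots>,n}\<^sup>n\<close> are 1-indexed extensional functions. As these agree outside
  \<open>{1..n}\<close>, the order \<open>\<le>\<close> of the type \<^typ>\<open>nat \<Rightarrow> nat\<close> restricts on them to
  the componentwise order.
\<close>

definition tamari :: "nat \<Rightarrow> (nat \<Rightarrow> nat) set" where
  "tamari n = {v \<in> {1..n} \<rightarrow>\<^sub>E {1..n}.
     (\<forall>i\<in>{1..n}. i \<le> v i) \<and>
     (\<forall>i\<in>{1..n}. \<forall>j\<in>{1..n}. i < j \<and> j \<le> v i \<longrightarrow> v j \<le> v i)}"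

definition Cov :: "'a::order set \<Rightarrow> ('a \<times> 'a) set" where
  "Cov L = {\<gamma> \<in> L \<times> L. fst \<gamma> < snd \<gamma> \<and> \<not> (\<exists>x\<in>L. fst \<gamma> < x \<and> x < snd \<gamma>)}"

definition cov_le :: "'a::order \<times> 'a \<Rightarrow> 'a \<times> 'a \<Rightarrow> bool" where
  "cov_le \<gamma> \<delta> \<longleftrightarrow> fst \<gamma> \<le> fst \<delta> \<and> \<not> snd \<gamma> \<le> fst \<delta> \<and> snd \<gamma> \<le> snd \<delta>"

definition Cov_component :: "'a::order set \<Rightarrow> 'a \<times> 'a \<Rightarrow> ('a \<times> 'a) set" where
  "Cov_component L \<gamma> =
     {\<delta> \<in> Cov L. (\<gamma>, \<delta>) \<in> {(x, y). x \<in> Cov L \<and> y \<in> Cov L \<and> (cov_le x y \<or> cov_le y x)}\<^sup>*}"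

text \<open>The second component of a cover of the least element is by definition an atom.\<close>

definition atomic_cover :: "'a::order set \<Rightarrow> 'a \<times> 'a \<Rightarrow> bool" where
  "atomic_cover L \<alpha> \<longleftrightarrow> \<alpha> \<in> Cov L \<and> (\<forall>x\<in>L. fst \<alpha> \<le> x)"

definition poset_isomorphic ::
    "'a set \<Rightarrow> ('a \<Rightarrow> 'a \<Rightarrow> bool) \<Rightarrow> 'b set \<Rightarrow> ('b \<Rightarrow> 'b \<Rightarrow> bool) \<Rightarrow> bool" where
  "poset_isomorphic A le_A B le_B \<longleftrightarrow>
     (\<exists>f. bij_betw f A B \<and> (\<forall>x\<in>A. \<forall>y\<in>A. le_A x y \<longleftrightarrow> le_B (f x) (f y)))"

end

theory Submission
  imports Defs
begin

text \<open>
  An atom of the Tamari lattice raises a single coordinate \<open>i\<close> of the bottom vector from \<open>i\<close> to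
  \<open>i + 1\<close>. The covers comparable to it, and in fact its whole component, are exactly the covers
  \<open>\<gamma>\<close> with \<open>\<gamma>\<^sub>0(i) = i < \<gamma>\<^sub>1(i)\<close>. In such a cover \<open>\<gamma>\<^sub>1\<close> is \<open>\<gamma>\<^sub>0\<close> with coordinate \<open>i\<close> replaced by
  \<open>\<gamma>\<^sub>0(i + 1)\<close>, and \<open>\<gamma>\<^sub>0\<close> ranges over the bracketing vectors that take the value \<open>i\<close> at
  coordinate \<open>i\<close> and nowhere else. Deleting the coordinate \<open>i\<close> and the value \<open>i\<close> identifies
  these vectors with the bracketing vectors of length \<open>n - 1\<close>.
\<close>

section \<open>Bracketing vectors\<close>

text \<open>The nesting clause may range over all j, since
  \<open>1 \<le> k < j \<le> v k \<le> n\<close> already puts j inside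
  \<open>{1..n}\<close>.\<close>

lemma tamari_iff:
  "v \<in> tamari n \<longleftrightarrow> v \<in> extensional {1..n} \<and>
     (\<forall>k\<in>{1..n}. k \<le> v k \<and> v k \<le> n \<and> (\<forall>j. k < j \<and> j \<le> v k \<longrightarrow> v j \<le> v k))"
  unfolding tamari_def PiE_def Pi_def by fastforce

lemma tamari_ge: "v \<in> tamari n \<Longrightarrow> k \<in> {1..n} \<Longrightarrow> k \<le> v k"
  and tamari_le_bound: "v \<in> tamari n \<Longrightarrow> k \<in> {1..n} \<Longrightarrow> v k \<le> n"
  and tamari_nested: "v \<in> tamari n \<Longrightarrow> k \<in> {1..n} \<Longrightarrow> k < j \<Longrightarrow> j \<le> v k \<Longrightarrow> v j \<le> v k"
  by (auto simp: tamari_iff)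

lemma tamari_le_iff:
  assumes "v \<in> tamari n" "w \<in> tamari n"
  shows "v \<le> w \<longleftrightarrow> (\<forall>k\<in>{1..n}. v k \<le> w k)"
  using assms unfolding tamari_iff le_fun_def extensional_def
  by (metis (mono_tags, lifting) mem_Collect_eq order_refl)

text \<open>Nesting at i becomes vacuous, and an earlier coordinate whose value reaches i only sees
  the entry at i shrink.\<close>

lemma tamari_reset:
  assumes "v \<in> tamari n" "i \<in> {1..n}"
  shows "v(i := i) \<in> tamari n"
  using assms by (auto simp: tamari_iff extensional_def)

text \<open>An earlier coordinate whose value reaches i has, by \<open>ne\<close>, a value of at
  least i + 1, so nesting bounds \<open>v (Suc i)\<close> by that value.\<close>

lemma tamari_raise:
  assumes v: "v \<in> tamari n" and i: "i \<in> {1..<n}" and vi: "v i = i"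
    and ne: "\<And>k. k \<in> {1..<i} \<Longrightarrow> v k \<noteq> i"
  shows "v(i := v (Suc i)) \<in> tamari n"
proof -
  have "v (Suc i) \<le> v k" if "k \<in> {1..n}" "k < i" "i \<le> v k" for k
    using that ne[of k] tamari_nested[OF v, of k "Suc i"] by auto
  moreover have "v j \<le> v (Suc i)" if "i < j" "j \<le> v (Suc i)" for j
    using that i tamari_nested[OF v, of "Suc i" j] by (cases "j = Suc i") auto
  moreover have "Suc i \<le> v (Suc i)" "v (Suc i) \<le> n"
    using i tamari_ge[OF v, of "Suc i"] tamari_le_bound[OF v, of "Suc i"] by auto
  ultimately show ?thesis
    using v i by (auto simp: tamari_iff extensional_def)
qed

section \<open>Covers raising a coordinate from its minimal value\<close>

definition raising_covers :: "nat \<Rightarrow> nat \<Rightarrow> ((nat \<Rightarrow> nat) \<times> (nat \<Rightarrow> nat)) set" where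
  "raising_covers n i = {\<gamma> \<in> Cov (tamari n). fst \<gamma> i = i \<and> i < snd \<gamma> i}"

text \<open>The cover is tested against two vectors of its interval: resetting the top determines
  the bottom, and raising the bottom then determines the top.\<close>

lemma raising_coversD:
  assumes \<gamma>: "\<gamma> \<in> raising_covers n i" and i: "i \<in> {1..n}"
  shows "i < n" "fst \<gamma> \<in> tamari n" "snd \<gamma> \<in> tamari n" "fst \<gamma> i = i"
    and "\<And>k. k \<in> {1..<i} \<Longrightarrow> fst \<gamma> k \<noteq> i"
    and "snd \<gamma> = (fst \<gamma>)(i := fst \<gamma> (Suc i))"
proof -
  obtain v w where vw: "\<gamma> = (v, w)" by fastforce
  with \<gamma> have v: "v \<in> tamari n" and w: "w \<in> tamari n" and less: "v < w"
    and cover: "\<And>x. x \<in> tamari n \<Longrightarrow> v < x \<Longrightarrow> \<not> x < w" and vi: "v i = i" and wi: "i < w i"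
    by (auto simp: raising_covers_def Cov_def)
  from wi tamari_le_bound[OF w i] have "i < n" by simp
  \<comment> \<open>Resetting coordinate \<open>i\<close> of the upper vector gives an element of the half-open interval.\<close>
  have "v \<le> w(i := i)" "w(i := i) \<le> w" "w(i := i) \<noteq> w"
    using less vi wi by (auto simp: le_fun_def less_le dest: fun_cong[of _ _ i])
  with cover[OF tamari_reset[OF w i]] have v_eq: "v = w(i := i)"
    by (auto simp: less_le)
  \<comment> \<open>If \<open>w k = i\<close> with k < i, nesting at k would force
    \<open>w i \<le> i\<close>.\<close>
  have ne: "v k \<noteq> i" if "k \<in> {1..<i}" for k
    using that i wi tamari_nested[OF w, of k i] by (auto simp: v_eq)
  have "v (Suc i) \<le> w i"
    using tamari_nested[OF w i, of "Suc i"] wi by (simp add: v_eq)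
  hence le: "v(i := v (Suc i)) \<le> w"
    by (simp add: v_eq le_fun_def)
  have "i < v (Suc i)"
    using tamari_ge[OF v, of "Suc i"] \<open>i < n\<close> by auto
  hence "v \<le> v(i := v (Suc i))" "v \<noteq> v(i := v (Suc i))"
    using vi by (auto simp: le_fun_def dest: fun_cong[of _ _ i])
  moreover have "v(i := v (Suc i)) \<in> tamari n"
    using i \<open>i < n\<close> by (intro tamari_raise v vi ne) auto
  \<comment> \<open>The raised vector is strictly above \<open>v\<close> and at most
    \<open>w\<close>, so the covering relation leaves only equality.\<close>
  ultimately have "w = v(i := v (Suc i))"
    using cover[of "v(i := v (Suc i))"] le by (auto simp: less_le)
  with v w vi ne vw \<open>i < n\<close> show "i < n" "fst \<gamma> \<in> tamari n" "snd \<gamma> \<in> tamari n" "fst \<gamma> i = i"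
    "\<And>k. k \<in> {1..<i} \<Longrightarrow> fst \<gamma> k \<noteq> i" "snd \<gamma> = (fst \<gamma>)(i := fst \<gamma> (Suc i))"
    by auto
qed

text \<open>A vector in the interval can differ from \<open>v\<close> only at i, and nesting there
  admits no value strictly between i and \<open>v (Suc i)\<close>.\<close>

lemma raising_coversI:
  assumes v: "v \<in> tamari n" and i: "i \<in> {1..<n}" and vi: "v i = i"
    and ne: "\<And>k. k \<in> {1..<i} \<Longrightarrow> v k \<noteq> i"
  shows "(v, v(i := v (Suc i))) \<in> raising_covers n i"
proof -
  let ?w = "v(i := v (Suc i))"
  have gt: "i < v (Suc i)"
    using tamari_ge[OF v, of "Suc i"] i by auto
  hence "v < ?w"
    using vi by (auto simp: less_le le_fun_def dest: fun_cong[of _ _ i])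
  moreover have False if x: "x \<in> tamari n" "v < x" "x < ?w" for x
  proof -
    have xk: "v k \<le> x k" "x k \<le> ?w k" for k
      using x by (auto simp: less_le le_fun_def)
    hence off: "x k = v k" if "k \<noteq> i" for k
      using that by (metis fun_upd_other order_antisym)
    have "x i \<noteq> i"
      using off vi x(2) by (metis ext less_irrefl)
    hence "Suc i \<le> x i"
      using xk(1)[of i] vi by simp
    hence "v (Suc i) \<le> x i"
      using tamari_nested[OF x(1), of i "Suc i"] off[of "Suc i"] i by simp
    hence "x i = ?w i"
      using xk(2)[of i] by simp
    hence "x = ?w"
      using off by (auto simp: fun_eq_iff)
    with x(3) show False by simp
  qed
  ultimately show ?thesis
    using v tamari_raise[OF v i vi ne] vi gt by (auto simp: raising_covers_def Cov_def)
qed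

text \<open>At coordinate i the upper vector of \<gamma> exceeds i while the lower vector of
  \<delta> equals i, which gives the middle clause of \<open>cov_le\<close>. The last clause holds
  because the upper vector depends monotonically on the lower one.\<close>

lemma raising_covers_le_iff:
  assumes \<gamma>: "\<gamma> \<in> raising_covers n i" and \<delta>: "\<delta> \<in> raising_covers n i" and i: "i \<in> {1..n}"
  shows "cov_le \<gamma> \<delta> \<longleftrightarrow> fst \<gamma> \<le> fst \<delta>"
proof -
  note D = raising_coversD[OF \<gamma> i] raising_coversD[OF \<delta> i]
  have "\<not> snd \<gamma> \<le> fst \<delta>"
    using \<gamma> \<delta> by (auto simp: raising_covers_def le_fun_def not_le intro!: exI[of _ i])
  moreover have "snd \<gamma> \<le> snd \<delta>" if "fst \<gamma> \<le> fst \<delta>"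
    using that unfolding D(6) D(12) by (simp add: le_fun_def)
  ultimately show ?thesis
    by (auto simp: cov_le_def)
qed

text \<open>Closure under comparability in both directions makes these covers a union of connected
  components.\<close>

lemma raising_covers_closed:
  assumes \<gamma>: "\<gamma> \<in> raising_covers n i" and i: "i \<in> {1..n}"
    and \<delta>: "\<delta> \<in> Cov (tamari n)" and comp: "cov_le \<gamma> \<delta> \<or> cov_le \<delta> \<gamma>"
  shows "\<delta> \<in> raising_covers n i"
proof -
  note D = raising_coversD[OF \<gamma> i]
  have \<delta>T: "fst \<delta> \<in> tamari n" "snd \<delta> \<in> tamari n"
    using \<delta> by (auto simp: Cov_def)
  have ge: "i \<le> fst \<delta> i"
    using tamari_ge[OF \<delta>T(1) i] .
  from comp show ?thesis
  proof
    assume le: "cov_le \<gamma> \<delta>"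
    hence f: "fst \<gamma> k \<le> fst \<delta> k" for k
      by (simp add: cov_le_def le_fun_def)
    \<comment> \<open>Off i, \<open>snd \<gamma>\<close> agrees with \<open>fst \<gamma>\<close> and
      so lies below \<open>fst \<delta>\<close>; the failure of
      \<open>snd \<gamma> \<le> fst \<delta>\<close> must occur at i.\<close>
    have "\<not> fst \<gamma> (Suc i) \<le> fst \<delta> i"
      using le f unfolding cov_le_def D(6) by (auto simp: le_fun_def split: if_splits)
    hence "\<not> fst \<delta> (Suc i) \<le> fst \<delta> i"
      using f[of "Suc i"] by simp
    \<comment> \<open>A larger value at i would enclose i + 1, and nesting would contradict the
      previous line.\<close>
    hence "fst \<delta> i = i"
      using tamari_nested[OF \<delta>T(1) i, of "Suc i"] ge by fastforce
    moreover have "snd \<gamma> i \<le> snd \<delta> i"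
      using le by (simp add: cov_le_def le_fun_def)
    ultimately show ?thesis
      using \<gamma> \<delta> by (simp add: raising_covers_def)
  next
    assume le: "cov_le \<delta> \<gamma>"
    hence "fst \<delta> i \<le> i"
      using D(4) by (metis cov_le_def le_fun_def)
    moreover have "i < snd \<delta> i"
    proof (rule ccontr)
      assume "\<not> i < snd \<delta> i"
      \<comment> \<open>Off i this is \<open>snd \<delta> \<le> snd \<gamma>\<close>; at i it is the
        assumption, as \<open>fst \<gamma> i = i\<close>.\<close>
      hence "snd \<delta> k \<le> fst \<gamma> k" for k
        using le D(4) unfolding cov_le_def D(6) le_fun_def
        by (cases "k = i") (auto split: if_splits)
      thus False
        using le by (simp add: cov_le_def le_fun_def)
    qed
    ultimately show ?thesis
      using \<delta> ge by (simp add: raising_covers_def)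
  qed
qed

lemma atomic_cover_raising:
  assumes "atomic_cover (tamari n) \<alpha>"
  obtains i where "i \<in> {1..n}" "\<alpha> \<in> raising_covers n i"
proof -
  have \<alpha>: "\<alpha> \<in> Cov (tamari n)" and bot: "\<And>x. x \<in> tamari n \<Longrightarrow> fst \<alpha> \<le> x"
    using assms by (auto simp: atomic_cover_def)
  hence T: "fst \<alpha> \<in> tamari n" "snd \<alpha> \<in> tamari n" and less: "fst \<alpha> < snd \<alpha>"
    by (auto simp: Cov_def)
  \<comment> \<open>The identity vector is the bottom element, so it forces the lower half of
    \<alpha> to be the identity on \<open>{1..n}\<close>.\<close>
  have "restrict id {1..n} \<in> tamari n"
    by (auto simp: tamari_iff)
  from bot[OF this] have *: "fst \<alpha> i = i" if "i \<in> {1..n}" for i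
    using tamari_ge[OF T(1) that] that by (auto simp: le_fun_def dest!: spec[of _ i])
  from less have "\<not> snd \<alpha> \<le> fst \<alpha>" by simp
  then obtain i where "i \<in> {1..n}" "fst \<alpha> i < snd \<alpha> i"
    unfolding tamari_le_iff[OF T(2,1)] by (auto simp: not_le)
  with * \<alpha> that show thesis
    by (simp add: raising_covers_def)
qed

text \<open>Closure under comparability confines the component. Conversely, the lower half of
  \<alpha> is the least element, so \<alpha> lies below every such cover and one comparability step
  reaches it.\<close>

lemma Cov_component_atomic:
  assumes \<alpha>: "atomic_cover (tamari n) \<alpha>" and i: "i \<in> {1..n}" and \<alpha>i: "\<alpha> \<in> raising_covers n i"
  shows "Cov_component (tamari n) \<alpha> = raising_covers n i"
proof (intro subset_antisym subsetI)
  fix \<delta> assume "\<delta> \<in> Cov_component (tamari n) \<alpha>"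
  hence "(\<alpha>, \<delta>) \<in> {(x, y). x \<in> Cov (tamari n) \<and> y \<in> Cov (tamari n) \<and>
    (cov_le x y \<or> cov_le y x)}\<^sup>*"
    by (simp add: Cov_component_def)
  thus "\<delta> \<in> raising_covers n i"
    by (induction rule: rtrancl_induct) (use \<alpha>i raising_covers_closed[OF _ i] in auto)
next
  fix \<delta> assume \<delta>: "\<delta> \<in> raising_covers n i"
  hence "cov_le \<alpha> \<delta>"
    using \<alpha> raising_coversD(2)[OF \<delta> i]
    by (simp add: raising_covers_le_iff[OF \<alpha>i _ i] atomic_cover_def)
  with \<alpha>i \<delta> show "\<delta> \<in> Cov_component (tamari n) \<alpha>"
    by (auto simp: raising_covers_def Cov_component_def intro!: r_into_rtrancl)
qed

section \<open>Deleting a coordinate together with its value\<close>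

text \<open>The increasing bijection from the naturals onto the naturals other than i.\<close>

definition skip :: "nat \<Rightarrow> nat \<Rightarrow> nat" where
  "skip i k = (if k < i then k else Suc k)"

text \<open>Inverse to \<open>skip i\<close> away from i. The value at i has no meaning, so uses of
  it rest on the argument differing from i.\<close>

definition unskip :: "nat \<Rightarrow> nat \<Rightarrow> nat" where
  "unskip i k = (if k < i then k else k - 1)"

lemma unskip_skip [simp]: "unskip i (skip i k) = k"
  and skip_unskip [simp]: "k \<noteq> i \<Longrightarrow> skip i (unskip i k) = k"
  and skip_neq [simp]: "skip i k \<noteq> i"
  and skip_le_iff [simp]: "skip i j \<le> skip i k \<longleftrightarrow> j \<le> k"
  and skip_less_iff [simp]: "skip i j < skip i k \<longleftrightarrow> j < k"
  by (auto simp: skip_def unskip_def)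

lemma unskip_le_iff:
  "j \<noteq> i \<Longrightarrow> k \<noteq> i \<Longrightarrow> unskip i j \<le> unskip i k \<longleftrightarrow> j \<le> k"
  by (metis skip_le_iff skip_unskip)

lemma skip_in_iff: "i \<in> {1..n} \<Longrightarrow> skip i k \<in> {1..n} \<longleftrightarrow> k \<in> {1..n - 1}"
  by (auto simp: skip_def)

lemma unskip_in_iff: "i \<in> {1..n} \<Longrightarrow> k \<noteq> i \<Longrightarrow> unskip i k \<in> {1..n - 1} \<longleftrightarrow> k \<in> {1..n}"
  by (metis skip_in_iff skip_unskip)

definition delete_coord :: "nat \<Rightarrow> nat \<Rightarrow> (nat \<Rightarrow> nat) \<Rightarrow> nat \<Rightarrow> nat" where
  "delete_coord n i v = (\<lambda>k\<in>{1..n - 1}. unskip i (v (skip i k)))"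

definition insert_coord :: "nat \<Rightarrow> nat \<Rightarrow> (nat \<Rightarrow> nat) \<Rightarrow> nat \<Rightarrow> nat" where
  "insert_coord n i u = (\<lambda>k\<in>{1..n}. if k = i then i else skip i (u (unskip i k)))"

text \<open>Past i every value exceeds i because \<open>k \<le> v k\<close>; the assumption covers
  the coordinates before i.\<close>

lemma tamari_avoid:
  assumes "v \<in> tamari n" "\<And>k. k \<in> {1..<i} \<Longrightarrow> v k \<noteq> i" "k \<in> {1..n}" "k \<noteq> i"
  shows "v k \<noteq> i"
  using assms(2)[of k] tamari_ge[OF assms(1,3)] assms(3,4) by (cases "k < i") auto

text \<open>Coordinates and values are relabelled by the same order isomorphism, and no remaining
  value is i, so each inequality transfers.\<close>

lemma delete_coord_tamari:
  assumes v: "v \<in> tamari n" and i: "i \<in> {1..n}" and ne: "\<And>k. k \<in> {1..<i} \<Longrightarrow> v k \<noteq> i"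
  shows "delete_coord n i v \<in> tamari (n - 1)"
proof -
  have skip_in: "skip i k \<in> {1..n}" if "k \<in> {1..n - 1}" for k
    using that i skip_in_iff by blast
  have neq: "v (skip i k) \<noteq> i" if "k \<in> {1..n - 1}" for k
    using tamari_avoid[OF v ne skip_in[OF that]] by simp
  have le: "j \<le> unskip i (v (skip i k)) \<longleftrightarrow> skip i j \<le> v (skip i k)"
    if "k \<in> {1..n - 1}" for j k
    using unskip_le_iff[of "skip i j" i "v (skip i k)"] neq[OF that] by simp
  have "k \<le> unskip i (v (skip i k)) \<and> unskip i (v (skip i k)) \<le> n - 1 \<and>
      (\<forall>j. k < j \<and> j \<le> unskip i (v (skip i k)) \<longrightarrow>
        unskip i (v (skip i j)) \<le> unskip i (v (skip i k)))" if k: "k \<in> {1..n - 1}" for k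
  proof (intro conjI allI impI)
    show "k \<le> unskip i (v (skip i k))"
      using le[OF k] tamari_ge[OF v skip_in[OF k]] by simp
    have "v (skip i k) \<in> {1..n}"
      using tamari_ge[OF v skip_in[OF k]] tamari_le_bound[OF v skip_in[OF k]] skip_in[OF k] by simp
    thus bound: "unskip i (v (skip i k)) \<le> n - 1"
      using unskip_in_iff[OF i neq[OF k]] by simp
    fix j assume j: "k < j \<and> j \<le> unskip i (v (skip i k))"
    hence "j \<in> {1..n - 1}"
      using bound k by simp
    moreover have "v (skip i j) \<le> v (skip i k)"
      using j le[OF k] by (intro tamari_nested[OF v skip_in[OF k]]) auto
    ultimately show "unskip i (v (skip i j)) \<le> unskip i (v (skip i k))"
      using neq k by (simp add: unskip_le_iff)
  qed
  thus ?thesis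
    by (fastforce simp: tamari_iff delete_coord_def)
qed

text \<open>Both vectors take the value i at i, so the deleted coordinate cannot affect the
  comparison.\<close>

lemma delete_coord_le_iff:
  assumes v: "v \<in> tamari n" "\<And>k. k \<in> {1..<i} \<Longrightarrow> v k \<noteq> i" "v i = i"
    and w: "w \<in> tamari n" "\<And>k. k \<in> {1..<i} \<Longrightarrow> w k \<noteq> i" "w i = i"
    and i: "i \<in> {1..n}"
  shows "delete_coord n i v \<le> delete_coord n i w \<longleftrightarrow> v \<le> w"
proof -
  have eq: "unskip i (v (skip i k)) \<le> unskip i (w (skip i k)) \<longleftrightarrow> v (skip i k) \<le> w (skip i k)"
    if "k \<in> {1..n - 1}" for k
  proof -
    have "skip i k \<in> {1..n}"
      using that i skip_in_iff by blast
    thus ?thesis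
      using tamari_avoid[OF v(1,2)] tamari_avoid[OF w(1,2)] by (simp add: unskip_le_iff)
  qed
  have "delete_coord n i v \<le> delete_coord n i w \<longleftrightarrow>
      (\<forall>k\<in>{1..n - 1}. v (skip i k) \<le> w (skip i k))"
    using eq tamari_le_iff[OF delete_coord_tamari[OF v(1) i v(2)] delete_coord_tamari[OF w(1) i w(2)]]
    by (simp add: delete_coord_def)
  also have "\<dots> \<longleftrightarrow> (\<forall>k\<in>{1..n}. v k \<le> w k)"
  proof (intro iffI ballI)
    fix k assume all: "\<forall>k\<in>{1..n - 1}. v (skip i k) \<le> w (skip i k)" and k: "k \<in> {1..n}"
    show "v k \<le> w k"
    proof (cases "k = i")
      case False
      with all unskip_in_iff[OF i False] k have "v (skip i (unskip i k)) \<le> w (skip i (unskip i k))"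
        by blast
      with False show ?thesis by simp
    qed (simp add: v w)
  next
    fix k assume "\<forall>k\<in>{1..n}. v k \<le> w k" "k \<in> {1..n - 1}"
    thus "v (skip i k) \<le> w (skip i k)"
      using skip_in_iff[OF i] by blast
  qed
  also have "\<dots> \<longleftrightarrow> v \<le> w"
    using tamari_le_iff[OF v(1) w(1)] by simp
  finally show ?thesis .
qed

lemma insert_coord_tamari:
  assumes u: "u \<in> tamari (n - 1)" and i: "i \<in> {1..n}"
  shows "insert_coord n i u \<in> tamari n"
proof -
  define f where "f = (\<lambda>k. if k = i then i else skip i (u (unskip i k)))"
  have "k \<le> f k \<and> f k \<le> n \<and> (\<forall>j. k < j \<and> j \<le> f k \<longrightarrow> f j \<le> f k)" if k: "k \<in> {1..n}" for k
  proof (cases "k = i")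
    case True
    thus ?thesis using i by (auto simp: f_def)
  next
    case False
    define k' where "k' = unskip i k"
    have k': "k' \<in> {1..n - 1}" and k_eq: "k = skip i k'"
      using False k unskip_in_iff[OF i False] by (simp_all add: k'_def)
    have fk: "f k = skip i (u k')"
      using False by (simp add: f_def k'_def)
    have "u k' \<in> {1..n - 1}"
      using tamari_ge[OF u k'] tamari_le_bound[OF u k'] k' by simp
    hence "f k \<le> n"
      using skip_in_iff[OF i, of "u k'"] fk by simp
    moreover have "k \<le> f k"
      using tamari_ge[OF u k'] fk k_eq by (metis skip_le_iff)
    moreover have "f j \<le> f k" if j: "k < j" "j \<le> f k" for j
    proof (cases "j = i")
      case True
      \<comment> \<open>Here \<open>f i = i\<close>, and \<open>j \<le> f k\<close> is already the
        claim.\<close>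
      thus ?thesis using j by (simp add: f_def)
    next
      case False
      define j' where "j' = unskip i j"
      have j_eq: "j = skip i j'"
        using False by (simp add: j'_def)
      have "k' < j'" "j' \<le> u k'"
        using j fk j_eq k_eq by (metis skip_less_iff, metis skip_le_iff)
      hence "u j' \<le> u k'"
        by (rule tamari_nested[OF u k'])
      thus ?thesis
        unfolding fk using False by (simp add: f_def j'_def)
    qed
    ultimately show ?thesis by blast
  qed
  moreover have "insert_coord n i u = restrict f {1..n}"
    by (simp add: insert_coord_def f_def)
  ultimately show ?thesis
    by (fastforce simp: tamari_iff)
qed

lemma insert_coord_self: "i \<in> {1..n} \<Longrightarrow> insert_coord n i u i = i"
  by (simp add: insert_coord_def)

lemma insert_coord_neq: "k \<in> {1..n} \<Longrightarrow> k \<noteq> i \<Longrightarrow> insert_coord n i u k \<noteq> i"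
  by (simp add: insert_coord_def)

lemma delete_insert_coord:
  assumes u: "u \<in> tamari (n - 1)" and i: "i \<in> {1..n}"
  shows "delete_coord n i (insert_coord n i u) = u"
proof
  fix k
  show "delete_coord n i (insert_coord n i u) k = u k"
  proof (cases "k \<in> {1..n - 1}")
    case True
    hence "skip i k \<in> {1..n}"
      using skip_in_iff[OF i] by blast
    with True show ?thesis
      by (simp add: delete_coord_def insert_coord_def)
  next
    case False
    moreover from this have "u k = undefined"
      using u unfolding tamari_iff by (blast intro: extensional_arb)
    ultimately show ?thesis
      by (simp only: delete_coord_def restrict_apply if_False)
  qed
qed

text \<open>A cover is recorded by its lower vector with coordinate i deleted. Order reflection and
  antisymmetry give injectivity; reinserting the coordinate gives surjectivity.\<close>

lemma raising_covers_isomorphic: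
  assumes i: "i \<in> {1..<n}"
  shows "poset_isomorphic (raising_covers n i) cov_le (tamari (n - 1)) (\<le>)"
proof -
  define f :: "(nat \<Rightarrow> nat) \<times> (nat \<Rightarrow> nat) \<Rightarrow> nat \<Rightarrow> nat"
    where "f = (\<lambda>\<gamma>. delete_coord n i (fst \<gamma>))"
  have i': "i \<in> {1..n}" using i by simp
  note D = raising_coversD[OF _ i']
  have f_le: "f \<gamma> \<le> f \<delta> \<longleftrightarrow> fst \<gamma> \<le> fst \<delta>"
    if "\<gamma> \<in> raising_covers n i" "\<delta> \<in> raising_covers n i" for \<gamma> \<delta>
    unfolding f_def
    by (rule delete_coord_le_iff) (use D[OF that(1)] D[OF that(2)] i' in blast)+
  have "inj_on f (raising_covers n i)"
  proof (rule inj_onI)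
    fix \<gamma> \<delta> assume *: "\<gamma> \<in> raising_covers n i" "\<delta> \<in> raising_covers n i" "f \<gamma> = f \<delta>"
    hence "fst \<gamma> = fst \<delta>"
      using f_le[of \<gamma> \<delta>] f_le[of \<delta> \<gamma>] by (simp add: antisym)
    thus "\<gamma> = \<delta>"
      using D(6)[OF *(1)] D(6)[OF *(2)] by (simp add: prod_eq_iff)
  qed
  moreover have "f ` raising_covers n i = tamari (n - 1)"
  proof (intro subset_antisym subsetI)
    fix u assume "u \<in> f ` raising_covers n i"
    thus "u \<in> tamari (n - 1)"
      using D(2,5) i' delete_coord_tamari by (auto simp: f_def)
  next
    fix u assume u: "u \<in> tamari (n - 1)"
    let ?v = "insert_coord n i u"
    have "(?v, ?v(i := ?v (Suc i))) \<in> raising_covers n i"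
      using i i' insert_coord_neq
      by (intro raising_coversI insert_coord_tamari[OF u] insert_coord_self) auto
    moreover have "u = f (?v, ?v(i := ?v (Suc i)))"
      by (simp add: f_def delete_insert_coord[OF u i'])
    ultimately show "u \<in> f ` raising_covers n i"
      by (rule rev_image_eqI)
  qed
  moreover have "cov_le \<gamma> \<delta> \<longleftrightarrow> f \<gamma> \<le> f \<delta>"
    if "\<gamma> \<in> raising_covers n i" "\<delta> \<in> raising_covers n i" for \<gamma> \<delta>
    using raising_covers_le_iff[OF that i'] f_le[OF that] by simp
  ultimately show ?thesis
    unfolding poset_isomorphic_def bij_betw_def by blast
qed

theorem proposition7p4:
  fixes n :: nat and \<alpha> :: "(nat \<Rightarrow> nat) \<times> (nat \<Rightarrow> nat)"
  assumes "atomic_cover (tamari n) \<alpha>"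
  shows "poset_isomorphic (Cov_component (tamari n) \<alpha>) cov_le (tamari (n - 1)) (\<le>)"
proof -
  obtain i where i: "i \<in> {1..n}" and \<alpha>: "\<alpha> \<in> raising_covers n i"
    using atomic_cover_raising[OF assms] .
  \<comment> \<open>Coordinate n is always n and cannot be raised, so i + 1 is a valid
    coordinate.\<close>
  have "i \<in> {1..<n}"
    using i raising_coversD(1)[OF \<alpha> i] by simp
  thus ?thesis
    using raising_covers_isomorphic Cov_component_atomic[OF assms i \<alpha>] by simp
qed

end
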